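(* Let $N\in\mathbb{N}$ be a positive multiple of $4$ and let $b_1$ be a nonzero real constant. The nontrivial solution $\mathbf{b}=(b_1,b_2,\dots,b_{N/2})\in\mathbb{R}^{N/2}$, with first component $b_1$, of the equations $$\psi^{(i,j,k,l)}(\mathbf{b})=0\quad\text{for all }(i,j,k,l)\in S_1\cup S_2$$ is given by $$b_r=\frac{b_1\sin^2\frac{\pi}{N}}{\sin^2\frac{r\pi}{N}}\quad(r=1,2,\dots,N/2-1),\qquad b_{N/2}=\frac{b_1}{2}\sin^2\frac{\pi}{N}.$$ That is, a vector $\mathbf b\in\mathbb{R}^{N/2}$ with first component $b_1$ solves these equations if and only if its components are given by these formulas.
   Context: Write $c_\alpha=\cos(\alpha\pi/N)$, $s_\alpha=\sin(\alpha\pi/N)$. For $(i,j,k,l)\in\mathbb{Z}^4$ and $\mathbf{b}=(b_1,\dots,b_{N/2})\in\mathbb{R}^{N/2}$ put $$\psi^{(i,j,k,l)}(\mathbf{b})=-\sum_{q=1}^{N/2}(-1)^q b_q f_q^{(i,j,k,l)},\qquad f_q^{(i,j,k,l)}=\begin{cases}c_{iq}c_{jq}c_{kq}c_{lq}&q\text{ odd},\\ s_{iq}s_{jq}s_{kq}s_{lq}&q\text{ even}.\end{cases}$$ The index sets are $S_1=\{(0,n+1,N/2-n,N/2-1)\mid 1\le n\le N/4-1\}$ and $S_2=\{(2-m,m,N/2-1,N/2-1)\mid m=1\text{ or }3\le m\le N/4+1\}$ ($n,m$ integers). *)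

theory Defs
  imports Complex_Main
begin

definition cN :: "nat \<Rightarrow> int \<Rightarrow> real" where
  "cN N \<alpha> = cos (of_int \<alpha> * pi / real N)"

definition sN :: "nat \<Rightarrow> int \<Rightarrow> real" where
  "sN N \<alpha> = sin (of_int \<alpha> * pi / real N)"

definition f_coeff :: "nat \<Rightarrow> nat \<Rightarrow> int \<times> int \<times> int \<times> int \<Rightarrow> real" where
  "f_coeff N q = (\<lambda>(i, j, k, l).
     if odd q
     then cN N (i * int q) * cN N (j * int q) * cN N (k * int q) * cN N (l * int q)
     else sN N (i * int q) * sN N (j * int q) * sN N (k * int q) * sN N (l * int q))"

(* A vector (b_1, ..., b_(N/2)) is represented by a function b :: nat => real, of which only the
   values at 1, ..., N div 2 matter. All halves and quarters of N below are exact when 4 dvd N. *)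
definition psi :: "nat \<Rightarrow> int \<times> int \<times> int \<times> int \<Rightarrow> (nat \<Rightarrow> real) \<Rightarrow> real" where
  "psi N x b = - (\<Sum>q = 1..N div 2. (- 1) ^ q * b q * f_coeff N q x)"

definition S1 :: "nat \<Rightarrow> (int \<times> int \<times> int \<times> int) set" where
  "S1 N = {(0, n + 1, int N div 2 - n, int N div 2 - 1) | n. 1 \<le> n \<and> n \<le> int N div 4 - 1}"

definition S2 :: "nat \<Rightarrow> (int \<times> int \<times> int \<times> int) set" where
  "S2 N = {(2 - m, m, int N div 2 - 1, int N div 2 - 1) | m.
             m = 1 \<or> (3 \<le> m \<and> m \<le> int N div 4 + 1)}"

end

theory Submission
  imports Defs "HOL-Computational_Algebra.Polynomial"
begin

text \<open>
  Write \<open>N = 4 M\<close> and \<open>x q = b q * (sin (q \<pi> / N))\<^sup>2\<close>. By product-to-sum formulas, the equations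
  involve \<open>x\<close> only through its two cosine transforms
  \<open>A t = (\<Sum>q odd. x q * cos (2 t q \<pi> / N))\<close> and \<open>B t = (\<Sum>q even. x q * cos (2 t q \<pi> / N))\<close>:
  those of \<open>S1\<close> say that \<open>A 1 + \<dots> + A n = 0\<close> for \<open>1 \<le> n < M\<close>, and those of \<open>S2\<close> (with \<open>m = t + 1\<close>)
  say that \<open>A t + A 1 = B t - B 1\<close> for \<open>t = 0\<close> and \<open>2 \<le> t \<le> M\<close>. Since \<open>cos (t \<theta>)\<close> for \<open>t < d\<close>
  spans the polynomials in \<open>cos \<theta>\<close> of degree less than \<open>d\<close>, the transforms determine the weights
  by interpolation. The first family forces \<open>x\<close> to be constant on odd indices; the second then
  determines it on even indices, with half weight at the endpoint \<open>q = N/2\<close>.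
\<close>

section \<open>Cosine sums\<close>

text \<open>Vanishing against \<open>cos (t * \<theta>)\<close> for all t below
  \<open>card I\<close> extends to every polynomial in cos \<theta> of degree below
  \<open>card I\<close>; a polynomial that vanishes at all nodes but one then isolates a single
  weight.\<close>

lemma weights_eq_0_if_cos_sums_eq_0:
  fixes z \<theta> :: "'a \<Rightarrow> real"
  assumes "finite I" and inj: "inj_on (\<lambda>i. cos (\<theta> i)) I"
    and zero: "\<And>t. t < card I \<Longrightarrow> (\<Sum>i\<in>I. z i * cos (real t * \<theta> i)) = 0"
    and "i \<in> I"
  shows "z i = 0"
proof -
  \<comment> \<open>The bound on \<open>k + t\<close> makes the induction close: one power of the
    cosine is traded for a shift of the frequency t by one, up or down.\<close>
  have pow: "k + t < card I \<Longrightarrow> (\<Sum>i\<in>I. z i * cos (\<theta> i) ^ k * cos (real t * \<theta> i)) = 0" for k t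
  proof (induction k arbitrary: t)
    case 0
    then show ?case using zero by simp
  next
    case (Suc k)
    show ?case
    proof (cases t)
      case 0
      then show ?thesis using Suc.IH[of 1] Suc.prems by (simp add: mult_ac)
    next
      case (Suc t')
      have "2 * (cos (\<theta> i) * cos (real t * \<theta> i)) =
          cos (real (Suc t) * \<theta> i) + cos (real t' * \<theta> i)" for i
        using cos_times_cos[of "real t * \<theta> i" "\<theta> i"] Suc by (simp add: algebra_simps)
      then have "2 * (z i * cos (\<theta> i) ^ Suc k * cos (real t * \<theta> i)) =
          z i * cos (\<theta> i) ^ k * cos (real (Suc t) * \<theta> i) +
          z i * cos (\<theta> i) ^ k * cos (real t' * \<theta> i)" for i
        by (simp add: distrib_left[symmetric] mult_ac del: of_nat_Suc)
      then have "2 * (\<Sum>i\<in>I. z i * cos (\<theta> i) ^ Suc k * cos (real t * \<theta> i)) =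
          (\<Sum>i\<in>I. z i * cos (\<theta> i) ^ k * cos (real (Suc t) * \<theta> i)) +
          (\<Sum>i\<in>I. z i * cos (\<theta> i) ^ k * cos (real t' * \<theta> i))"
        by (simp only: sum_distrib_left sum.distrib[symmetric])
      then show ?thesis
        using Suc.IH[of "Suc t"] Suc.IH[of t'] Suc.prems \<open>t = Suc t'\<close> by simp
    qed
  qed
  have poly0: "(\<Sum>i\<in>I. z i * poly p (cos (\<theta> i))) = 0" if "degree p < card I" for p
  proof -
    have "(\<Sum>i\<in>I. z i * poly p (cos (\<theta> i))) =
        (\<Sum>k\<le>degree p. coeff p k * (\<Sum>i\<in>I. z i * cos (\<theta> i) ^ k))"
      unfolding poly_altdef sum_distrib_left by (subst sum.swap) (simp add: mult_ac)
    also have "\<dots> = 0"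
      using pow[where t = 0] that by (intro sum.neutral) auto
    finally show ?thesis .
  qed
  \<comment> \<open>Unnormalised Lagrange polynomial of the node i; its degree is
    \<open>card I - 1\<close>, and \<open>inj\<close> keeps its value at that node nonzero.\<close>
  define p where "p = (\<Prod>l\<in>I - {i}. [:- cos (\<theta> l), 1:])"
  have "degree p = card (I - {i})"
    unfolding p_def by (subst degree_prod_eq_sum_degree) auto
  then have "degree p < card I"
    using card_Diff1_less[OF assms(1,4)] by simp
  then have "0 = (\<Sum>l\<in>I. z l * poly p (cos (\<theta> l)))"
    using poly0 by simp
  also have "\<dots> = (\<Sum>l\<in>{i}. z l * poly p (cos (\<theta> l)))"
    by (rule sum.mono_neutral_right) (use assms(1,4) in \<open>auto simp: p_def poly_prod\<close>)
  finally have "z i * poly p (cos (\<theta> i)) = 0" by simp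
  moreover have "poly p (cos (\<theta> i)) \<noteq> 0"
    using assms(1,4) inj by (auto simp: p_def poly_prod inj_on_def)
  ultimately show ?thesis by simp
qed

lemma inj_on_cos_nodes:
  fixes g :: "'a \<Rightarrow> nat"
  assumes "d > 0" "inj_on g I" "\<And>i. i \<in> I \<Longrightarrow> g i \<le> d"
  shows "inj_on (\<lambda>i. cos (real (g i) * pi / real d)) I"
proof (rule inj_onI)
  fix i j assume ij: "i \<in> I" "j \<in> I"
    and eq: "cos (real (g i) * pi / real d) = cos (real (g j) * pi / real d)"
  have "0 \<le> real (g k) * pi / real d \<and> real (g k) * pi / real d \<le> pi" if "k \<in> I" for k
    using assms(1) assms(3)[OF that] by (simp add: pos_divide_le_eq mult.commute)
  then have "real (g i) * pi / real d = real (g j) * pi / real d"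
    using cos_inj_pi[OF _ _ _ _ eq] ij by blast
  then show "i = j" using assms(1,2) ij by (simp add: inj_on_eq_iff)
qed

text \<open>Multiplied by 2 sin \<phi>, where 2 \<phi> is the step of the angles, the sum telescopes
  to sin (t \<pi>) = 0. The bound t < 2 M places \<phi> below \<pi>, so sin \<phi> can be
  cancelled.\<close>

lemma sum_cos_odd_multiples:
  assumes "0 < t" "t < 2 * M"
  shows "(\<Sum>j<M. cos (real t * (real (2 * j + 1) * pi / (2 * real M)))) = 0"
proof -
  define \<phi> where "\<phi> = real t * pi / (2 * real M)"
  have "0 < \<phi>" "\<phi> < pi" using assms by (auto simp: \<phi>_def field_simps)
  then have s: "sin \<phi> > 0" by (rule sin_gt_zero)
  have "2 * sin \<phi> * (\<Sum>j<M. cos (real (2 * j + 1) * \<phi>)) =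
      (\<Sum>j<M. sin (real (2 * Suc j) * \<phi>) - sin (real (2 * j) * \<phi>))"
    unfolding sum_distrib_left
    by (intro sum.cong refl, subst sin_diff_sin) (simp add: algebra_simps add_divide_distrib)
  also have "\<dots> = sin (real (2 * M) * \<phi>)"
    by (subst sum_lessThan_telescope) simp
  also have "real (2 * M) * \<phi> = real t * pi" using assms by (simp add: \<phi>_def)
  finally show ?thesis using s by (simp add: \<phi>_def mult_ac)
qed

text \<open>Telescoping as for the odd multiples. With -1/2 moved to the left, this is the
  trapezoidal rule on the nodes 0 to M, both ends having weight 1/2.\<close>

lemma sum_cos_trapezoidal:
  assumes "0 < t" "t \<le> M"
  shows "(\<Sum>r=1..<M. cos (real t * (real r * pi / real M))) + (- 1) ^ t / 2 = - 1 / 2"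
proof -
  define \<phi> where "\<phi> = real t * pi / (2 * real M)"
  have "0 < \<phi>" "\<phi> < pi" using assms by (auto simp: \<phi>_def field_simps)
  then have s: "sin \<phi> > 0" by (rule sin_gt_zero)
  have "2 * sin \<phi> * (\<Sum>r=1..<M. cos (real (2 * r) * \<phi>)) =
      (\<Sum>r=1..<M. sin (real (2 * Suc r) * \<phi> - \<phi>) - sin (real (2 * r) * \<phi> - \<phi>))"
    unfolding sum_distrib_left
    by (intro sum.cong refl, subst sin_diff_sin) (simp add: algebra_simps add_divide_distrib)
  also have "\<dots> = sin (real (2 * M) * \<phi> - \<phi>) - sin \<phi>"
    using assms by (subst sum_Suc_diff') auto
  also have "real (2 * M) * \<phi> = real t * pi" using assms by (simp add: \<phi>_def)
  finally have "sin \<phi> * (2 * (\<Sum>r=1..<M. cos (real (2 * r) * \<phi>)) + (- 1) ^ t + 1) = 0"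
    by (simp add: sin_diff algebra_simps)
  with s have "2 * (\<Sum>r=1..<M. cos (real (2 * r) * \<phi>)) + (- 1) ^ t + 1 = 0"
    by simp
  then show ?thesis by (simp add: \<phi>_def mult_ac)
qed

section \<open>Inverting the cosine transforms\<close>

text \<open>For N = 4 M, \<open>u j\<close> is the weight at q = 2 j + 1, and \<open>v r\<close> in
  \<open>even_transform\<close> the weight at q = 2 r; both angles equal 2 q \<pi> / N.\<close>

definition odd_transform :: "nat \<Rightarrow> (nat \<Rightarrow> real) \<Rightarrow> nat \<Rightarrow> real" where
  "odd_transform M u t = (\<Sum>j<M. u j * cos (real t * (real (2 * j + 1) * pi / (2 * real M))))"

definition even_transform :: "nat \<Rightarrow> (nat \<Rightarrow> real) \<Rightarrow> nat \<Rightarrow> real" where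
  "even_transform M v t = (\<Sum>r=1..M. v r * cos (real t * (real r * pi / real M)))"

lemma odd_transform_const:
  assumes "\<And>j. j < M \<Longrightarrow> u j = K" "t < 2 * M"
  shows "odd_transform M u t = (if t = 0 then real M * K else 0)"
proof -
  have "odd_transform M u t = K * (\<Sum>j<M. cos (real t * (real (2 * j + 1) * pi / (2 * real M))))"
    unfolding odd_transform_def sum_distrib_left using assms by (intro sum.cong) auto
  then show ?thesis using sum_cos_odd_multiples[of t M] assms by auto
qed

lemma odd_transform_diff:
  "odd_transform M (\<lambda>j. u j - w j) t = odd_transform M u t - odd_transform M w t"
  by (simp add: odd_transform_def sum_subtractf left_diff_distrib)

lemma even_transform_diff:
  "even_transform M (\<lambda>j. u j - w j) t = even_transform M u t - even_transform M w t"
  by (simp add: even_transform_def sum_subtractf left_diff_distrib)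

text \<open>Subtracting the mean K makes frequency 0 vanish too and leaves the others unchanged.
  Then M frequencies vanish on M distinct nodes, so every deviation from K is zero.\<close>

lemma odd_transform_eq_0_iff:
  assumes "M > 0"
  shows "(\<forall>t\<in>{1..<M}. odd_transform M u t = 0) \<longleftrightarrow> (\<forall>j<M. u j = u 0)"
proof
  assume *: "\<forall>t\<in>{1..<M}. odd_transform M u t = 0"
  define K where "K = (\<Sum>j<M. u j) / real M"
  have "inj_on (\<lambda>j. cos (real (2 * j + 1) * pi / (2 * real M))) {..<M}"
    using inj_on_cos_nodes[of "2 * M" "\<lambda>j. 2 * j + 1" "{..<M}"] assms by (simp add: inj_on_def)
  moreover have "(\<Sum>j<M. (u j - K) * cos (real t * (real (2 * j + 1) * pi / (2 * real M)))) = 0"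
    if "t < M" for t
  proof -
    have "odd_transform M (\<lambda>j. u j - K) t = 0"
    proof (cases "t = 0")
      case True
      then show ?thesis using assms by (simp add: odd_transform_def sum_subtractf K_def)
    next
      case False
      then show ?thesis
        using * that odd_transform_const[of M "\<lambda>_. K" K t] by (simp add: odd_transform_diff)
    qed
    then show ?thesis by (simp add: odd_transform_def)
  qed
  ultimately have "u j - K = 0" if "j < M" for j
    using that
      weights_eq_0_if_cos_sums_eq_0[where z = "\<lambda>j. u j - K" and I = "{..<M}"
        and \<theta> = "\<lambda>j. real (2 * j + 1) * pi / (2 * real M)"]
    by simp
  then show "\<forall>j<M. u j = u 0" using assms by simp
next
  assume "\<forall>j<M. u j = u 0"
  then have "odd_transform M u t = (if t = 0 then real M * u 0 else 0)" if "t < 2 * M" for t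
    using that by (intro odd_transform_const) blast+
  then show "\<forall>t\<in>{1..<M}. odd_transform M u t = 0" by simp
qed

text \<open>These are K times the trapezoidal weights without the node 0, whose missing share
  accounts for the term \<open>- K / 2\<close>.\<close>

lemma even_transform_const:
  assumes "M > 0" "t \<le> M"
  shows "even_transform M (\<lambda>r. if r = M then K / 2 else K) t =
    (if t = 0 then real M * K else 0) - K / 2"
proof -
  have "{1..M} = insert M {1..<M}" using assms by auto
  then have "even_transform M (\<lambda>r. if r = M then K / 2 else K) t =
      K / 2 * cos (real t * pi) + (\<Sum>r=1..<M. K * cos (real t * (real r * pi / real M)))"
    using assms by (simp add: even_transform_def cong: sum.cong_simp)
  also have "\<dots> = K * ((\<Sum>r=1..<M. cos (real t * (real r * pi / real M))) + (- 1) ^ t / 2)"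
    by (simp add: sum_distrib_left algebra_simps)
  also have "\<dots> = (if t = 0 then real M * K else 0) - K / 2"
  proof (cases "t = 0")
    case True
    then show ?thesis using assms by (simp add: of_nat_diff algebra_simps)
  next
    case False
    then show ?thesis by (subst sum_cos_trapezoidal) (use assms in auto)
  qed
  finally show ?thesis .
qed

lemma even_transform_const_imp_0:
  assumes "M > 0" and E: "\<And>t. t \<le> M \<Longrightarrow> even_transform M v t = E" and r: "r \<in> {1..M}"
  shows "v r = 0"
proof -
  \<comment> \<open>The common value \<open>E\<close> is cancelled by a weight \<open>- E\<close> at the extra node \<open>0\<close>.\<close>
  define z where "z = (\<lambda>r. if r = 0 then - E else v r)"
  have "inj_on (\<lambda>r. cos (real r * pi / real M)) {0..M}"
    using inj_on_cos_nodes[of M "\<lambda>r. r" "{0..M}"] assms(1) by simp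
  moreover have "(\<Sum>r=0..M. z r * cos (real t * (real r * pi / real M))) = 0" if "t \<le> M" for t
    using E[OF that] by (simp add: sum.atLeast_Suc_atMost even_transform_def z_def)
  ultimately have "z r = 0"
    using weights_eq_0_if_cos_sums_eq_0[where z = z and I = "{0..M}"
        and \<theta> = "\<lambda>r. real r * pi / real M"] r
    by simp
  then show ?thesis using r by (simp add: z_def)
qed

text \<open>The trapezoidal weights \<open>w\<close> are a particular solution. For any solution
  \<open>v\<close>, the transform of \<open>v - w\<close> does not depend on the frequency, which
  forces \<open>v = w\<close> on the nodes. At t = 1 the equation would be trivial.\<close>

lemma even_transform_eq_iff:
  assumes "M > 0"
  shows "(\<forall>t\<in>{0..M}. t \<noteq> 1 \<longrightarrow>
      even_transform M v t - even_transform M v 1 = (if t = 0 then real M * K else 0)) \<longleftrightarrow>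
    (\<forall>r\<in>{1..<M}. v r = K) \<and> v M = K / 2" (is "?L \<longleftrightarrow> ?R")
proof -
  define w where "w = (\<lambda>r. if r = M then K / 2 else K)"
  have w: "even_transform M w t = (if t = 0 then real M * K else 0) - K / 2" if "t \<le> M" for t
    unfolding w_def using even_transform_const[OF assms that] .
  have R: "?R \<longleftrightarrow> (\<forall>r\<in>{1..M}. v r = w r)"
    using assms by (auto simp: w_def)
  show ?thesis
  proof
    assume L: ?L
    \<comment> \<open>The summand \<open>K / 2\<close> appears because the transform of
      \<open>w\<close> at frequency 1 is \<open>- K / 2\<close>.\<close>
    have "even_transform M (\<lambda>r. v r - w r) t = even_transform M v 1 + K / 2" if "t \<le> M" for t
      using L w[OF that] that unfolding even_transform_diff by (cases "t = 1") auto
    then have "v r - w r = 0" if "r \<in> {1..M}" for r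
      using even_transform_const_imp_0[OF assms] that by blast
    then show ?R unfolding R by simp
  next
    assume ?R
    then have "even_transform M v t = even_transform M w t" for t
      unfolding R even_transform_def by (intro sum.cong) auto
    then show ?L using w assms by simp
  qed
qed

section \<open>The equations in terms of the transforms\<close>

lemma sum_split_parity:
  fixes g :: "nat \<Rightarrow> real"
  shows "(\<Sum>q=1..2 * M. g q) = (\<Sum>j<M. g (2 * j + 1)) + (\<Sum>r=1..M. g (2 * r))"
  by (induction M) auto

text \<open>Raising n by one adds sin \<theta> cos (2 (n + 1) \<theta>) to the left side. This is
  why the equations of \<open>S1\<close> become partial sums of a transform.\<close>

lemma cos_sin_eq_sum_cos:
  fixes \<theta> :: real
  shows "cos (real (n + 1) * \<theta>) * sin (real n * \<theta>) = sin \<theta> * (\<Sum>k=1..n. cos (real k * (2 * \<theta>)))"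
proof (induction n)
  case (Suc n)
  have "cos (real (n + 2) * \<theta>) * sin (real (n + 1) * \<theta>) - cos (real (n + 1) * \<theta>) * sin (real n * \<theta>) =
      (sin (real (2 * n + 3) * \<theta>) - sin (real (2 * n + 1) * \<theta>)) / 2"
    unfolding cos_times_sin by (simp add: algebra_simps add_divide_distrib diff_divide_distrib)
  also have "\<dots> = sin \<theta> * cos (real (n + 1) * (2 * \<theta>))"
    unfolding sin_diff_sin by (simp add: algebra_simps add_divide_distrib)
  finally show ?case using Suc.IH by (simp add: algebra_simps)
qed simp

text \<open>The angle is q \<pi> / 2 minus a q \<pi> / N, and cos (q \<pi> / 2) = 0 for odd q, so
  the cosine turns into a sine. The remaining sign disappears when two such factors are
  multiplied.\<close>

lemma cN_reflect:
  assumes "M > 0" "odd q"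
  shows "cN (4 * M) ((2 * int M - a) * int q) =
    sin (real q * pi / 2) * sin (of_int a * (real q * pi / real (4 * M)))"
proof -
  have "of_int ((2 * int M - a) * int q) * pi / real (4 * M) =
      real q * pi / 2 - of_int a * (real q * pi / real (4 * M))"
    using assms by (simp add: field_simps)
  moreover have "cos (real q * pi / 2) = 0"
    using assms(2) by (auto elim!: oddE simp: add_divide_distrib distrib_right cos_add)
  ultimately show ?thesis by (simp add: cN_def cos_diff)
qed

lemma sN_reflect:
  assumes "M > 0" "even q"
  shows "sN (4 * M) ((2 * int M - a) * int q) =
    - cos (real q * pi / 2) * sin (of_int a * (real q * pi / real (4 * M)))"
proof -
  have "of_int ((2 * int M - a) * int q) * pi / real (4 * M) =
      real q * pi / 2 - of_int a * (real q * pi / real (4 * M))"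
    using assms by (simp add: field_simps)
  moreover have "sin (real q * pi / 2) = 0"
    using assms(2) by (auto elim!: evenE)
  ultimately show ?thesis by (simp add: sN_def sin_diff)
qed

text \<open>At even q the index 0 contributes the factor sin 0, so this family sees odd components
  only. At odd q the last two factors reflect to sin (n \<theta>) sin \<theta>.\<close>

lemma f_coeff_S1:
  assumes "M > 0"
  shows "f_coeff (4 * M) q (0, int n + 1, 2 * int M - int n, 2 * int M - 1) =
    (if odd q then (sin (real q * pi / real (4 * M)))\<^sup>2 *
       (\<Sum>k=1..n. cos (real k * (2 * (real q * pi / real (4 * M))))) else 0)"
proof (cases "odd q")
  case True
  define \<theta> where "\<theta> = real q * pi / real (4 * M)"
  have "(sin (real q * pi / 2))\<^sup>2 = 1"
    using True by (auto elim!: oddE simp: add_divide_distrib distrib_right sin_add power_mult[symmetric])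
  moreover have "cN (4 * M) ((int n + 1) * int q) = cos (real (n + 1) * \<theta>)"
    by (simp add: cN_def \<theta>_def algebra_simps)
  moreover have "cN (4 * M) ((2 * int M - int n) * int q) = sin (real q * pi / 2) * sin (real n * \<theta>)"
    "cN (4 * M) ((2 * int M - 1) * int q) = sin (real q * pi / 2) * sin \<theta>"
    using cN_reflect[OF assms True, of "int n"] cN_reflect[OF assms True, of 1]
    by (simp_all only: \<theta>_def of_int_of_nat_eq of_int_1 mult_1)
  ultimately have "f_coeff (4 * M) q (0, int n + 1, 2 * int M - int n, 2 * int M - 1) =
      cos (real (n + 1) * \<theta>) * sin (real n * \<theta>) * sin \<theta>"
    using True by (simp add: f_coeff_def power2_eq_square cN_def[of _ 0] del: of_nat_add)
  also have "\<dots> = (sin \<theta>)\<^sup>2 * (\<Sum>k=1..n. cos (real k * (2 * \<theta>)))"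
    unfolding cos_sin_eq_sum_cos by (simp add: power2_eq_square)
  finally show ?thesis using True by (simp add: \<theta>_def)
qed (simp add: f_coeff_def sN_def)

text \<open>Here m = t + 1. The first two indices have sum 2 and difference 2 t up to sign, so
  product-to-sum yields cos (2 t \<theta>) plus (odd q) or minus (even q) cos (2 \<theta>); the two
  equal indices yield the squared sine.\<close>

lemma f_coeff_S2:
  assumes "M > 0"
  shows "f_coeff (4 * M) q (1 - int t, int t + 1, 2 * int M - 1, 2 * int M - 1) =
    (sin (real q * pi / real (4 * M)))\<^sup>2 *
      (cos (real t * (2 * (real q * pi / real (4 * M)))) -
        (- 1) ^ q * cos (2 * (real q * pi / real (4 * M)))) / 2"
proof -
  define \<theta> where "\<theta> = real q * pi / real (4 * M)"
  have arg: "of_int ((1 - int t) * int q) * pi / real (4 * M) = (1 - real t) * \<theta>"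
    "of_int ((int t + 1) * int q) * pi / real (4 * M) = (1 + real t) * \<theta>"
    by (simp_all add: \<theta>_def algebra_simps)
  have pm: "(1 - real t) * \<theta> - (1 + real t) * \<theta> = - (real t * (2 * \<theta>))"
    "(1 - real t) * \<theta> + (1 + real t) * \<theta> = 2 * \<theta>"
    by (simp_all add: algebra_simps)
  show ?thesis
  proof (cases "odd q")
    case True
    have "(sin (real q * pi / 2))\<^sup>2 = 1"
      using True by (auto elim!: oddE simp: add_divide_distrib distrib_right sin_add power_mult[symmetric])
    then have "cN (4 * M) ((2 * int M - 1) * int q) * cN (4 * M) ((2 * int M - 1) * int q) = (sin \<theta>)\<^sup>2"
      unfolding cN_reflect[OF assms True, of 1]
      by (simp add: \<theta>_def power2_eq_square)
    moreover have "cN (4 * M) ((1 - int t) * int q) * cN (4 * M) ((int t + 1) * int q) =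
        (cos (real t * (2 * \<theta>)) + cos (2 * \<theta>)) / 2"
      unfolding cN_def arg cos_times_cos pm by simp
    moreover have "f_coeff (4 * M) q (1 - int t, int t + 1, 2 * int M - 1, 2 * int M - 1) =
        (cN (4 * M) ((1 - int t) * int q) * cN (4 * M) ((int t + 1) * int q)) *
        (cN (4 * M) ((2 * int M - 1) * int q) * cN (4 * M) ((2 * int M - 1) * int q))"
      using True by (simp add: f_coeff_def)
    ultimately show ?thesis
      using True unfolding \<theta>_def[symmetric] by simp
  next
    case False
    then have q: "even q" by simp
    then have "(cos (real q * pi / 2))\<^sup>2 = 1"
      by (auto elim!: evenE simp: power_mult[symmetric])
    then have "sN (4 * M) ((2 * int M - 1) * int q) * sN (4 * M) ((2 * int M - 1) * int q) = (sin \<theta>)\<^sup>2"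
      unfolding sN_reflect[OF assms q, of 1]
      by (simp add: \<theta>_def power2_eq_square)
    moreover have "sN (4 * M) ((1 - int t) * int q) * sN (4 * M) ((int t + 1) * int q) =
        (cos (real t * (2 * \<theta>)) - cos (2 * \<theta>)) / 2"
      unfolding sN_def arg sin_times_sin pm by simp
    moreover have "f_coeff (4 * M) q (1 - int t, int t + 1, 2 * int M - 1, 2 * int M - 1) =
        (sN (4 * M) ((1 - int t) * int q) * sN (4 * M) ((int t + 1) * int q)) *
        (sN (4 * M) ((2 * int M - 1) * int q) * sN (4 * M) ((2 * int M - 1) * int q))"
      using False by (simp add: f_coeff_def)
    ultimately show ?thesis
      using False unfolding \<theta>_def[symmetric] by simp
  qed
qed

section \<open>From the coefficients to the functional \<open>psi\<close>\<close>

definition scaled :: "nat \<Rightarrow> (nat \<Rightarrow> real) \<Rightarrow> nat \<Rightarrow> real" where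
  "scaled N b q = b q * (sin (real q * pi / real N))\<^sup>2"

lemma psi_S1:
  assumes "M > 0"
  shows "psi (4 * M) (0, int n + 1, 2 * int M - int n, 2 * int M - 1) b =
    (\<Sum>k=1..n. odd_transform M (\<lambda>j. scaled (4 * M) b (2 * j + 1)) k)"
proof -
  have half: "4 * M div 2 = 2 * M" by simp
  have angle: "2 * (real (2 * j + 1) * pi / real (4 * M)) = real (2 * j + 1) * pi / (2 * real M)"
    "2 * (real (2 * j) * pi / real (4 * M)) = real j * pi / real M" for j
    by simp_all
  have "psi (4 * M) (0, int n + 1, 2 * int M - int n, 2 * int M - 1) b =
      (\<Sum>j<M. \<Sum>k=1..n. scaled (4 * M) b (2 * j + 1) *
         cos (real k * (real (2 * j + 1) * pi / (2 * real M))))"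
    unfolding psi_def half sum_split_parity f_coeff_S1[OF assms] angle
    by (simp add: sum_negf scaled_def sum_distrib_left mult_ac)
  then show ?thesis unfolding odd_transform_def by (subst sum.swap) simp
qed

lemma psi_S2:
  fixes b :: "nat \<Rightarrow> real"
  assumes "M > 0"
  defines "A \<equiv> odd_transform M (\<lambda>j. scaled (4 * M) b (2 * j + 1))"
    and "B \<equiv> even_transform M (\<lambda>r. scaled (4 * M) b (2 * r))"
  shows "psi (4 * M) (1 - int t, int t + 1, 2 * int M - 1, 2 * int M - 1) b =
    (A t + A 1 - (B t - B 1)) / 2"
proof -
  have half: "4 * M div 2 = 2 * M" by simp
  have angle: "2 * (real (2 * j + 1) * pi / real (4 * M)) = real (2 * j + 1) * pi / (2 * real M)"
    "2 * (real (2 * j) * pi / real (4 * M)) = real j * pi / real M" for j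
    by simp_all
  \<comment> \<open>Writing \<open>real 1\<close> keeps the second cosines in the shape of the
    transforms at frequency 1, so the sums fold back into \<open>A\<close> and
    \<open>B\<close>.\<close>
  have "2 * psi (4 * M) (1 - int t, int t + 1, 2 * int M - 1, 2 * int M - 1) b =
      (\<Sum>j<M. scaled (4 * M) b (2 * j + 1) *
         (cos (real t * (real (2 * j + 1) * pi / (2 * real M))) +
          cos (real 1 * (real (2 * j + 1) * pi / (2 * real M))))) -
      (\<Sum>r=1..M. scaled (4 * M) b (2 * r) *
         (cos (real t * (real r * pi / real M)) - cos (real 1 * (real r * pi / real M))))"
    unfolding psi_def half sum_split_parity f_coeff_S2[OF assms(1)] angle
    by (simp add: sum_negf scaled_def sum_distrib_left mult_ac)
  also have "\<dots> = A t + A 1 - (B t - B 1)"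
    unfolding A_def B_def odd_transform_def even_transform_def
    by (simp only: distrib_left right_diff_distrib sum.distrib sum_subtractf)
  finally show ?thesis by simp
qed

lemma psi_S1_all:
  assumes "M > 0"
  shows "(\<forall>x\<in>S1 (4 * M). psi (4 * M) x b = 0) \<longleftrightarrow>
    (\<forall>k\<in>{1..<M}. odd_transform M (\<lambda>j. scaled (4 * M) b (2 * j + 1)) k = 0)"
proof -
  define A where "A = odd_transform M (\<lambda>j. scaled (4 * M) b (2 * j + 1))"
  have "S1 (4 * M) =
      (\<lambda>n. (0, int n + 1, 2 * int M - int n, 2 * int M - 1)) ` {1..<M}"
  proof (intro equalityI subsetI)
    fix x assume "x \<in> S1 (4 * M)"
    then obtain n where n: "1 \<le> n" "n \<le> int M - 1"
      "x = (0, n + 1, 2 * int M - n, 2 * int M - 1)"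
      by (auto simp: S1_def)
    then show "x \<in> (\<lambda>n. (0, int n + 1, 2 * int M - int n, 2 * int M - 1)) ` {1..<M}"
      by (intro image_eqI[of _ _ "nat n"]) auto
  qed (force simp: S1_def)
  then have "(\<forall>x\<in>S1 (4 * M). psi (4 * M) x b = 0) \<longleftrightarrow> (\<forall>n\<in>{1..<M}. (\<Sum>k=1..n. A k) = 0)"
    using psi_S1[OF assms] by (simp add: A_def)
  also have "\<dots> \<longleftrightarrow> (\<forall>k\<in>{1..<M}. A k = 0)"
  proof
    assume *: "\<forall>n\<in>{1..<M}. (\<Sum>k=1..n. A k) = 0"
    show "\<forall>k\<in>{1..<M}. A k = 0"
    proof
      fix k assume k: "k \<in> {1..<M}"
      then obtain l where l: "k = Suc l" by (cases k) auto
      \<comment> \<open>For k = 1 the shorter partial sum is empty and is not among the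
        equations.\<close>
      have "(\<Sum>i=1..l. A i) = 0" using * k l by (cases "l = 0") auto
      moreover have "(\<Sum>i=1..k. A i) = 0" using * k by blast
      ultimately show "A k = 0" using l by simp
    qed
  qed simp
  finally show ?thesis by (simp add: A_def)
qed

lemma psi_S2_all:
  fixes b :: "nat \<Rightarrow> real"
  assumes "M > 0"
  defines "A \<equiv> odd_transform M (\<lambda>j. scaled (4 * M) b (2 * j + 1))"
    and "B \<equiv> even_transform M (\<lambda>r. scaled (4 * M) b (2 * r))"
  shows "(\<forall>x\<in>S2 (4 * M). psi (4 * M) x b = 0) \<longleftrightarrow>
    (\<forall>t\<in>{0..M}. t \<noteq> 1 \<longrightarrow> A t + A 1 = B t - B 1)"
proof -
  \<comment> \<open>With t = m - 1, the case m = 1 becomes t = 0 and 3 \<le> m \<le> M + 1 becomes 2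
    \<le> t \<le> M; the gap m = 2 is t = 1.\<close>
  have "S2 (4 * M) =
      (\<lambda>t. (1 - int t, int t + 1, 2 * int M - 1, 2 * int M - 1)) ` ({0..M} - {1})"
  proof (intro equalityI subsetI)
    fix x assume "x \<in> S2 (4 * M)"
    then obtain m where m: "m = 1 \<or> 3 \<le> m \<and> m \<le> int M + 1"
      "x = (2 - m, m, 2 * int M - 1, 2 * int M - 1)"
      by (auto simp: S2_def)
    then show "x \<in> (\<lambda>t. (1 - int t, int t + 1, 2 * int M - 1, 2 * int M - 1)) ` ({0..M} - {1})"
      by (intro image_eqI[of _ _ "nat (m - 1)"]) auto
  next
    fix x assume "x \<in> (\<lambda>t. (1 - int t, int t + 1, 2 * int M - 1, 2 * int M - 1)) ` ({0..M} - {1})"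
    then obtain t where "t \<in> {0..M} - {1}"
      "x = (1 - int t, int t + 1, 2 * int M - 1, 2 * int M - 1)" by (rule imageE)
    then show "x \<in> S2 (4 * M)"
      unfolding S2_def by (intro CollectI exI[of _ "int t + 1"]) auto
  qed
  then have "(\<forall>x\<in>S2 (4 * M). psi (4 * M) x b = 0) \<longleftrightarrow>
      (\<forall>t\<in>{0..M} - {1}. (A t + A 1 - (B t - B 1)) / 2 = 0)"
    by (simp only: ball_simps psi_S2[OF assms(1), of _ b] A_def B_def)
  then show ?thesis by auto
qed

section \<open>Solving for the scaled weights and returning to \<open>b\<close>\<close>

theorem lemma6:
  fixes N :: nat and b1 :: real and b :: "nat \<Rightarrow> real"
  assumes "N > 0" and "4 dvd N"
    and "b1 \<noteq> 0"
    and "b 1 = b1"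
  shows "(\<forall>x \<in> S1 N \<union> S2 N. psi N x b = 0) \<longleftrightarrow>
         (\<forall>r \<in> {1..N div 2 - 1}. b r = b1 * (sin (pi / real N))\<^sup>2 / (sin (real r * pi / real N))\<^sup>2) \<and>
         b (N div 2) = b1 / 2 * (sin (pi / real N))\<^sup>2"
proof -
  obtain M where N: "N = 4 * M" using assms(2) by auto
  have M: "M > 0" using assms(1) N by simp
  define x where "x = scaled N b"
  \<comment> \<open>The common value on odd indices is fixed by the prescribed first
    component.\<close>
  define K where "K = x 1"
  define A where "A = odd_transform M (\<lambda>j. x (2 * j + 1))"
  define B where "B = even_transform M (\<lambda>r. x (2 * r))"
  have K: "K = b1 * (sin (pi / real N))\<^sup>2"
    using assms(4) by (simp add: K_def x_def scaled_def)
  have "(\<forall>y \<in> S1 N \<union> S2 N. psi N y b = 0) \<longleftrightarrow>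
      (\<forall>k\<in>{1..<M}. A k = 0) \<and> (\<forall>t\<in>{0..M}. t \<noteq> 1 \<longrightarrow> A t + A 1 = B t - B 1)"
    using psi_S1_all[OF M, of b] psi_S2_all[OF M, of b]
    unfolding A_def B_def x_def N by blast
  also have "(\<forall>k\<in>{1..<M}. A k = 0) \<longleftrightarrow> (\<forall>j<M. x (2 * j + 1) = K)"
    unfolding A_def odd_transform_eq_0_iff[OF M] by (simp add: K_def)
  also have "(\<forall>j<M. x (2 * j + 1) = K) \<and> (\<forall>t\<in>{0..M}. t \<noteq> 1 \<longrightarrow> A t + A 1 = B t - B 1) \<longleftrightarrow>
      (\<forall>j<M. x (2 * j + 1) = K) \<and> (\<forall>r\<in>{1..<M}. x (2 * r) = K) \<and> x (2 * M) = K / 2"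
  \<comment> \<open>Once the odd weights are constant, \<open>A\<close> is known at all t \<le> M,
    including t = M, which \<open>S1\<close> does not reach. The equations of \<open>S2\<close> then
    constrain \<open>B\<close> alone.\<close>
  proof (rule conj_cong[OF refl])
    assume "\<forall>j<M. x (2 * j + 1) = K"
    then have "A t = (if t = 0 then real M * K else 0)" if "t \<le> M" for t
      unfolding A_def using odd_transform_const[of M "\<lambda>j. x (2 * j + 1)" K t] that M by simp
    then have "(\<forall>t\<in>{0..M}. t \<noteq> 1 \<longrightarrow> A t + A 1 = B t - B 1) \<longleftrightarrow>
        (\<forall>t\<in>{0..M}. t \<noteq> 1 \<longrightarrow> B t - B 1 = (if t = 0 then real M * K else 0))"
      using M by (intro ball_cong imp_cong refl) auto
    also have "\<dots> \<longleftrightarrow> (\<forall>r\<in>{1..<M}. x (2 * r) = K) \<and> x (2 * M) = K / 2"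
      unfolding B_def by (rule even_transform_eq_iff[OF M])
    finally show "(\<forall>t\<in>{0..M}. t \<noteq> 1 \<longrightarrow> A t + A 1 = B t - B 1) \<longleftrightarrow>
        (\<forall>r\<in>{1..<M}. x (2 * r) = K) \<and> x (2 * M) = K / 2" .
  qed
  also have "\<dots> \<longleftrightarrow> (\<forall>q\<in>{1..N div 2 - 1}. x q = K) \<and> x (N div 2) = K / 2"
  proof -
    have "(\<forall>q\<in>{1..N div 2 - 1}. x q = K) \<longleftrightarrow>
        (\<forall>j<M. x (2 * j + 1) = K) \<and> (\<forall>r\<in>{1..<M}. x (2 * r) = K)"
    proof (intro iffI ballI)
      fix q assume *: "(\<forall>j<M. x (2 * j + 1) = K) \<and> (\<forall>r\<in>{1..<M}. x (2 * r) = K)"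
        and q: "q \<in> {1..N div 2 - 1}"
      show "x q = K"
      proof (cases "even q")
        case True
        then obtain r where "q = 2 * r" by (rule evenE)
        then show ?thesis using * q N by auto
      next
        case False
        then obtain j where "q = 2 * j + 1" by (rule oddE)
        then show ?thesis using * q N by auto
      qed
    qed (auto simp: N)
    then show ?thesis by (auto simp: N)
  qed
  \<comment> \<open>At q = N/2 the sine is sin (\<pi> / 2) = 1, so the half weight is the value of b
    itself.\<close>
  also have "x (N div 2) = b (N div 2)"
    using M by (simp add: x_def scaled_def N)
  also have "(\<forall>q\<in>{1..N div 2 - 1}. x q = K) \<longleftrightarrow>
      (\<forall>q\<in>{1..N div 2 - 1}. b q = K / (sin (real q * pi / real N))\<^sup>2)"
  proof (rule ball_cong[OF refl])
    fix q assume "q \<in> {1..N div 2 - 1}"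
    then have "0 < q" "q < N" by auto
    then have "sin (real q * pi / real N) > 0"
      by (intro sin_gt_zero) (auto simp: field_simps)
    then show "x q = K \<longleftrightarrow> b q = K / (sin (real q * pi / real N))\<^sup>2"
      by (simp add: x_def scaled_def field_simps)
  qed
  finally show ?thesis by (simp add: K)
qed

end
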